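(* Let $a,b$ be positive real numbers, let $\nu\in(0,1)$, let $n\ge1$ be an integer, and put $h=\frac{b}{a}$. Then $$K(h^{\frac{1}{2^{n-1}}},2)^{r_n}\,(a^{1-\nu}b^{\nu})^2\;\le\;\big((1-\nu)a+\nu b\big)^2-r_0^2(a-b)^2-\sum_{k=1}^{n-1}r_k\Big[a^{1-\frac{m_k}{2^k}}b^{\frac{m_k}{2^k}}-a^{1-\frac{m_k+1}{2^k}}b^{\frac{m_k+1}{2^k}}\Big]^2\;\le\;K(h^{\frac{1}{2^{n-1}}},2)^{R_n}\,(a^{1-\nu}b^{\nu})^2.$$
   Context: For $t>0$, $K(t,2)=\frac{(1+t)^2}{4t}$ (Kantorovich constant). For $\nu\in[0,1]$ and integers $k\ge 0$: $m_k=\lfloor 2^k\nu\rfloor$; $r_0=\min\{\nu,1-\nu\}$ and $r_k=\min\{2r_{k-1},1-2r_{k-1}\}$ for $k\ge 1$; $R_k=1-r_k$. An empty sum is $0$. *)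

theory Defs
  imports Complex_Main
begin

text \<open>The Kantorovich constant \<open>K(t,2) = (1+t)\<^sup>2 / (4t)\<close>, of interest for \<open>t > 0\<close>.\<close>

definition kantorovich2 :: "real \<Rightarrow> real" where
  "kantorovich2 t = (1 + t)\<^sup>2 / (4 * t)"

definition m_idx :: "real \<Rightarrow> nat \<Rightarrow> int" where
  "m_idx \<nu> k = \<lfloor>2 ^ k * \<nu>\<rfloor>"

primrec r_seq :: "real \<Rightarrow> nat \<Rightarrow> real" where
  "r_seq \<nu> 0 = min \<nu> (1 - \<nu>)"
| "r_seq \<nu> (Suc k) = min (2 * r_seq \<nu> k) (1 - 2 * r_seq \<nu> k)"

definition R_seq :: "real \<Rightarrow> nat \<Rightarrow> real" where
  "R_seq \<nu> k = 1 - r_seq \<nu> k"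

end

theory Submission
  imports Defs "HOL-Analysis.Convex"
begin

text \<open>Let \<open>g s = a\<^bsup>1-s\<^esup> b\<^bsup>s\<^esup>\<close> and let \<open>\<lambda>\<close> be the fractional part of \<open>2\<^sup>n \<nu>\<close>. Halving the
  interval \<open>[m\<^sub>k/2\<^sup>k, (m\<^sub>k+1)/2\<^sup>k]\<close> containing \<open>\<nu>\<close> and using \<open>g s * g t = g ((s+t)/2)\<^sup>2\<close>, each
  subtracted square replaces the interpolation of \<open>g\<^sup>2\<close> between the end points of one interval by the
  interpolation at the next level. The middle term thus telescopes to \<open>(1-\<lambda>) x + \<lambda> y\<close>, where
  \<open>x\<close> and \<open>y\<close> are the values of \<open>g\<^sup>2\<close> at the end points at level \<open>n\<close>. Since
  \<open>y/x = h\<^bsup>1/2^(n-1)\<^esup>\<close>, \<open>r\<^sub>n = min \<lambda> (1-\<lambda>)\<close> and \<open>x\<^bsup>1-\<lambda>\<^esup> y\<^bsup>\<lambda>\<^esup> = g \<nu>\<^sup>2\<close>, what remains is the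
  two-sided Young inequality with Kantorovich constant, which is two instances of the
  concavity of \<open>ln\<close>.\<close>

section \<open>Two-sided Young inequality with the Kantorovich constant\<close>

lemma ln_weighted_mean_ge:
  fixes x y t :: real
  assumes "x > 0" "y > 0" "0 \<le> t" "t \<le> 1"
  shows "(1 - t) * ln x + t * ln y \<le> ln ((1 - t) * x + t * y)"
  using concave_onD[OF ln_concave, of t x y] assms by simp

lemma weighted_mean_pos:
  fixes x y t :: real
  assumes "x > 0" "y > 0" "0 \<le> t" "t \<le> 1"
  shows "(1 - t) * x + t * y > 0"
  using assms by (cases "t = 0") (auto intro: add_nonneg_pos)

text \<open>This displays the constant as the squared quotient of the arithmetic and the geometric
  mean, which makes its symmetry in \<open>x\<close> and \<open>y\<close> visible.\<close>

lemma kantorovich2_ratio: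
  assumes "x > 0" "y > 0"
  shows "kantorovich2 (y / x) = ((x + y) / 2)\<^sup>2 / (x * y)"
  using assms by (simp add: kantorovich2_def field_simps power2_eq_square)

lemma kantorovich2_pos: "t > 0 \<Longrightarrow> kantorovich2 t > 0"
  by (simp add: kantorovich2_def)

lemma ln_kantorovich2_ratio:
  assumes "x > 0" "y > 0"
  shows "ln (kantorovich2 (y / x)) = 2 * ln ((x + y) / 2) - ln x - ln y"
  using assms by (simp add: kantorovich2_ratio ln_div ln_mult ln_realpow)

lemma kantorovich2_ratio_commute:
  assumes "x > 0" "y > 0"
  shows "kantorovich2 (y / x) = kantorovich2 (x / y)"
  using assms by (simp add: kantorovich2_ratio add.commute mult.commute)

text \<open>With \<open>w\<close> the weighted mean and \<open>z\<close> the midpoint, expanding ln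
  K as 2 ln z - ln x - ln y turns the bounds into (1-2t) ln x + 2t ln z \<le> ln w and (1-2t) ln y +
  ln w \<le> 2(1-t) ln z.\<close>

lemma ln_young_kantorovich_half:
  fixes x y t :: real
  assumes "x > 0" "y > 0" "0 \<le> t" "t \<le> 1 / 2"
  shows "t * ln (kantorovich2 (y / x)) + ((1 - t) * ln x + t * ln y) \<le> ln ((1 - t) * x + t * y)"
    and "ln ((1 - t) * x + t * y) \<le> (1 - t) * ln (kantorovich2 (y / x)) + ((1 - t) * ln x + t * ln y)"
proof -
  define w z where "w = (1 - t) * x + t * y" and "z = (x + y) / 2"
  have pos: "w > 0" "z > 0"
    using assms by (auto simp: w_def z_def intro: weighted_mean_pos)
  have "(1 - 2 * t) * x + 2 * t * z = w"
    by (simp add: w_def z_def field_simps)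
  then have "(1 - 2 * t) * ln x + 2 * t * ln z \<le> ln w"
    using ln_weighted_mean_ge[of x z "2 * t"] assms pos by simp
  then show "t * ln (kantorovich2 (y / x)) + ((1 - t) * ln x + t * ln y) \<le> ln ((1 - t) * x + t * y)"
    using assms by (simp add: ln_kantorovich2_ratio w_def z_def algebra_simps)
  \<comment> \<open>For the upper bound, \<open>z\<close> is in turn a weighted mean of \<open>w\<close> and \<open>y\<close>.\<close>
  define q where "q = 1 / (2 * (1 - t))"
  \<comment> \<open>Comparing the coefficients of \<open>x\<close> in \<open>w\<close> and
    \<open>z\<close> forces q(1-t) = 1/2; \<open>q \<le> 1\<close> amounts to
    \<open>t \<le> 1 / 2\<close>.\<close>
  have q: "2 * (1 - t) * q = 1" "0 \<le> q" "q \<le> 1"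
    using assms by (auto simp: q_def field_simps)
  have "2 * (1 - t) * ((1 - q) * y + q * w) = 2 * (1 - t) * z"
  proof -
    have "2 * (1 - t) * ((1 - q) * y + q * w)
        = 2 * (1 - t) * y - (2 * (1 - t) * q) * y + (2 * (1 - t) * q) * w"
      by (simp add: algebra_simps)
    also have "\<dots> = 2 * (1 - t) * z"
      unfolding q by (simp add: w_def z_def field_simps)
    finally show ?thesis .
  qed
  then have "(1 - q) * y + q * w = z"
    using assms by simp
  then have "(1 - q) * ln y + q * ln w \<le> ln z"
    using ln_weighted_mean_ge[of y w q] assms pos q by simp
  then have "2 * (1 - t) * ((1 - q) * ln y + q * ln w) \<le> 2 * (1 - t) * ln z"
    using assms by (intro mult_left_mono) auto
  moreover have "2 * (1 - t) * ((1 - q) * ln y + q * ln w)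
      = 2 * (1 - t) * ln y - (2 * (1 - t) * q) * ln y + (2 * (1 - t) * q) * ln w"
    by (simp add: algebra_simps)
  ultimately have "(1 - 2 * t) * ln y + ln w \<le> 2 * (1 - t) * ln z"
    unfolding q by (simp add: algebra_simps)
  then show "ln ((1 - t) * x + t * y) \<le> (1 - t) * ln (kantorovich2 (y / x)) + ((1 - t) * ln x + t * ln y)"
    using assms by (simp add: ln_kantorovich2_ratio w_def z_def algebra_simps)
qed

lemma ln_young_kantorovich:
  fixes x y t :: real
  assumes "x > 0" "y > 0" "0 \<le> t" "t \<le> 1"
  defines "r \<equiv> min t (1 - t)"
  shows "r * ln (kantorovich2 (y / x)) + ((1 - t) * ln x + t * ln y) \<le> ln ((1 - t) * x + t * y)"
    and "ln ((1 - t) * x + t * y) \<le> (1 - r) * ln (kantorovich2 (y / x)) + ((1 - t) * ln x + t * ln y)"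
proof -
  have "r * ln (kantorovich2 (y / x)) + ((1 - t) * ln x + t * ln y) \<le> ln ((1 - t) * x + t * y) \<and>
    ln ((1 - t) * x + t * y) \<le> (1 - r) * ln (kantorovich2 (y / x)) + ((1 - t) * ln x + t * ln y)"
  proof (cases "t \<le> 1 / 2")
    case True
    then have "r = t" by (simp add: r_def)
    then show ?thesis
      using ln_young_kantorovich_half[of x y t] assms True by simp
  next
    case False
    then have "r = 1 - t" by (simp add: r_def)
    \<comment> \<open>Exchanging \<open>x\<close> with \<open>y\<close> and \<open>t\<close> with
      \<open>1 - t\<close> preserves both the weighted mean and the constant.\<close>
    then show ?thesis
      using ln_young_kantorovich_half[of y x "1 - t"] assms False
      by (simp add: kantorovich2_ratio_commute[of x y] add.commute)
  qed
  then show "r * ln (kantorovich2 (y / x)) + ((1 - t) * ln x + t * ln y) \<le> ln ((1 - t) * x + t * y)"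
    and "ln ((1 - t) * x + t * y) \<le> (1 - r) * ln (kantorovich2 (y / x)) + ((1 - t) * ln x + t * ln y)"
    by auto
qed

lemma young_kantorovich:
  fixes x y t :: real
  assumes "x > 0" "y > 0" "0 \<le> t" "t \<le> 1"
  defines "r \<equiv> min t (1 - t)"
  shows "kantorovich2 (y / x) powr r * (x powr (1 - t) * y powr t) \<le> (1 - t) * x + t * y"
    and "(1 - t) * x + t * y \<le> kantorovich2 (y / x) powr (1 - r) * (x powr (1 - t) * y powr t)"
proof -
  have pos: "kantorovich2 (y / x) > 0" "(1 - t) * x + t * y > 0"
    using assms kantorovich2_pos weighted_mean_pos by auto
  have prod: "kantorovich2 (y / x) powr s * (x powr (1 - t) * y powr t)
      = exp (s * ln (kantorovich2 (y / x)) + ((1 - t) * ln x + t * ln y))" for s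
    using pos assms by (simp add: powr_def exp_add)
  show "kantorovich2 (y / x) powr r * (x powr (1 - t) * y powr t) \<le> (1 - t) * x + t * y"
    unfolding prod using ln_young_kantorovich(1)[OF assms(1-4)] pos
    by (simp add: r_def ln_ge_iff)
  have "exp (ln ((1 - t) * x + t * y)) \<le> kantorovich2 (y / x) powr (1 - r) * (x powr (1 - t) * y powr t)"
    unfolding prod exp_le_cancel_iff r_def by (rule ln_young_kantorovich(2)[OF assms(1-4)])
  then show "(1 - t) * x + t * y \<le> kantorovich2 (y / x) powr (1 - r) * (x powr (1 - t) * y powr t)"
    using pos by simp
qed

section \<open>Dyadic interpolation of squared geometric means\<close>

definition geo_mean :: "real \<Rightarrow> real \<Rightarrow> real \<Rightarrow> real" where
  "geo_mean a b s = a powr (1 - s) * b powr s"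

lemma geo_mean_eq_exp:
  "a > 0 \<Longrightarrow> b > 0 \<Longrightarrow> geo_mean a b s = exp ((1 - s) * ln a + s * ln b)"
  by (simp add: geo_mean_def powr_def exp_add)

lemma geo_mean_midpoint:
  assumes "a > 0" "b > 0" "s + t = 2 * u"
  shows "(geo_mean a b u)\<^sup>2 = geo_mean a b s * geo_mean a b t"
proof -
  have "2 * ((1 - u) * ln a + u * ln b)
      = (2 - 2 * u) * ln a + (2 * u) * ln b"
    by (simp add: algebra_simps)
  also have "\<dots> = ((1 - s) * ln a + s * ln b) + ((1 - t) * ln a + t * ln b)"
    unfolding assms(3)[symmetric] by (simp add: algebra_simps)
  finally show ?thesis
    using assms by (simp add: geo_mean_eq_exp flip: exp_add exp_double)
qed

lemma m_idx_Suc: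
  "m_idx \<nu> (Suc k) = (if frac (2 ^ k * \<nu>) < 1 / 2 then 2 * m_idx \<nu> k else 2 * m_idx \<nu> k + 1)"
  unfolding m_idx_def by (auto simp: frac_def floor_eq_iff; linarith)

lemma frac_Suc:
  fixes \<nu> :: real
  shows "frac (2 ^ Suc k * \<nu>) =
    (if frac (2 ^ k * \<nu>) < 1 / 2 then 2 * frac (2 ^ k * \<nu>) else 2 * frac (2 ^ k * \<nu>) - 1)"
  using m_idx_Suc[of \<nu> k] by (auto simp: frac_def m_idx_def)

text \<open>So \<open>r_seq \<nu> n\<close> is the distance d from \<open>2 ^ n * \<nu>\<close> to
  the nearest integer: doubling the argument sends d to min(2d, 1-2d), which is the
  recursion.\<close>

lemma r_seq_eq_min_frac:
  assumes "0 < \<nu>" "\<nu> < 1"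
  shows "r_seq \<nu> n = min (frac (2 ^ n * \<nu>)) (1 - frac (2 ^ n * \<nu>))"
proof (induction n)
  case 0
  have "frac \<nu> = \<nu>" using assms by (simp add: frac_eq)
  then show ?case by simp
next
  case (Suc n)
  define l where "l = frac (2 ^ n * \<nu>)"
  have l: "0 \<le> l" "l < 1" by (auto simp: l_def frac_lt_1)
  show ?case
    unfolding frac_Suc using Suc l by (auto simp: min_def simp flip: l_def)
qed

text \<open>The height at \<open>\<nu>\<close> of the chord of the squared geometric mean over the
  level-\<open>k\<close> dyadic interval containing \<open>\<nu>\<close>.\<close>

definition dyadic_interp :: "real \<Rightarrow> real \<Rightarrow> real \<Rightarrow> nat \<Rightarrow> real" where
  "dyadic_interp a b \<nu> k = (1 - frac (2 ^ k * \<nu>)) * (geo_mean a b (m_idx \<nu> k / 2 ^ k))\<^sup>2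
     + frac (2 ^ k * \<nu>) * (geo_mean a b ((m_idx \<nu> k + 1) / 2 ^ k))\<^sup>2"

text \<open>If l < 1/2, removing l(x-y)^2 from (1-l)x^2 + l y^2 leaves (1-2l)x^2 + 2l xy. As xy is
  the squared mean at the midpoint, this is the chord over the left half; the other case is its
  mirror image.\<close>

lemma dyadic_interp_Suc:
  assumes "a > 0" "b > 0" "0 < \<nu>" "\<nu> < 1"
  shows "dyadic_interp a b \<nu> (Suc k) = dyadic_interp a b \<nu> k
     - r_seq \<nu> k * (geo_mean a b (m_idx \<nu> k / 2 ^ k) - geo_mean a b ((m_idx \<nu> k + 1) / 2 ^ k))\<^sup>2"
proof -
  define l m where "l = frac (2 ^ k * \<nu>)" and "m = real_of_int (m_idx \<nu> k)"
  define x y where "x = geo_mean a b (m / 2 ^ k)" and "y = geo_mean a b ((m + 1) / 2 ^ k)"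
  have mid: "(geo_mean a b ((2 * m + 1) / 2 ^ Suc k))\<^sup>2 = x * y"
    unfolding x_def y_def using assms by (intro geo_mean_midpoint) (auto simp: field_simps)
  have ends: "geo_mean a b (2 * m / 2 ^ Suc k) = x" "geo_mean a b ((2 * m + 2) / 2 ^ Suc k) = y"
    unfolding x_def y_def by (auto intro!: arg_cong[where f = "geo_mean a b"] simp: field_simps)
  have r: "r_seq \<nu> k = min l (1 - l)"
    using r_seq_eq_min_frac assms by (simp add: l_def)
  have "dyadic_interp a b \<nu> (Suc k) = (1 - l) * x\<^sup>2 + l * y\<^sup>2 - min l (1 - l) * (x - y)\<^sup>2"
  proof (cases "l < 1 / 2")
    case True
    have "dyadic_interp a b \<nu> (Suc k) = (1 - 2 * l) * x\<^sup>2 + 2 * l * (x * y)"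
      unfolding dyadic_interp_def frac_Suc m_idx_Suc
      using True mid ends by (simp del: power_Suc flip: l_def m_def)
    then show ?thesis
      using True by (simp add: min_absorb1 power2_eq_square algebra_simps)
  next
    case False
    have "dyadic_interp a b \<nu> (Suc k) = (2 - 2 * l) * (x * y) + (2 * l - 1) * y\<^sup>2"
      unfolding dyadic_interp_def frac_Suc m_idx_Suc
      using False mid ends by (simp del: power_Suc add: add.assoc flip: l_def m_def)
    then show ?thesis
      using False by (simp add: min_absorb2 power2_eq_square algebra_simps)
  qed
  then show ?thesis
    by (simp add: dyadic_interp_def r x_def y_def l_def m_def)
qed

lemma dyadic_interp_one:
  assumes "a > 0" "b > 0" "0 < \<nu>" "\<nu> < 1"
  shows "dyadic_interp a b \<nu> 1 = ((1 - \<nu>) * a + \<nu> * b)\<^sup>2 - (r_seq \<nu> 0)\<^sup>2 * (a - b)\<^sup>2"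
proof -
  have "frac \<nu> = \<nu>" "\<lfloor>\<nu>\<rfloor> = 0"
    using assms by (auto simp: frac_eq floor_eq_iff)
  then have "dyadic_interp a b \<nu> 0 = (1 - \<nu>) * a\<^sup>2 + \<nu> * b\<^sup>2" "m_idx \<nu> 0 = 0"
    using assms by (auto simp: dyadic_interp_def m_idx_def geo_mean_def)
  then have "dyadic_interp a b \<nu> 1
      = (1 - \<nu>) * a\<^sup>2 + \<nu> * b\<^sup>2 - min \<nu> (1 - \<nu>) * (a - b)\<^sup>2"
    using dyadic_interp_Suc[OF assms, of 0] assms by (simp add: geo_mean_def)
  \<comment> \<open>The variance term c(1-c)(a-b)^2 combines with -c(a-b)^2 to -c^2(a-b)^2; hence
    \<open>r_seq \<nu> 0\<close> is squared, unlike the later weights.\<close>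
  moreover have "(1 - c) * a\<^sup>2 + c * b\<^sup>2 - c * (a - b)\<^sup>2 = ((1 - c) * a + c * b)\<^sup>2 - c\<^sup>2 * (a - b)\<^sup>2"
      for c a b :: real
    by (simp add: power2_eq_square algebra_simps)
  from this[of \<nu> a b] this[of "1 - \<nu>" b a]
  have "(1 - \<nu>) * a\<^sup>2 + \<nu> * b\<^sup>2 - min \<nu> (1 - \<nu>) * (a - b)\<^sup>2
      = ((1 - \<nu>) * a + \<nu> * b)\<^sup>2 - (min \<nu> (1 - \<nu>))\<^sup>2 * (a - b)\<^sup>2"
    by (simp add: min_def add.commute power2_commute[of b a])
  ultimately show ?thesis
    by simp
qed

lemma dyadic_interp_eq_sum:
  assumes "a > 0" "b > 0" "0 < \<nu>" "\<nu> < 1"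
  shows "dyadic_interp a b \<nu> (Suc n) = ((1 - \<nu>) * a + \<nu> * b)\<^sup>2 - (r_seq \<nu> 0)\<^sup>2 * (a - b)\<^sup>2
    - (\<Sum>k = 1..n. r_seq \<nu> k *
        (geo_mean a b (m_idx \<nu> k / 2 ^ k) - geo_mean a b ((m_idx \<nu> k + 1) / 2 ^ k))\<^sup>2)"
proof (induction n)
  case 0
  then show ?case using dyadic_interp_one[OF assms] by simp
next
  case (Suc n)
  then show ?case using dyadic_interp_Suc[OF assms, of "Suc n"] by simp
qed

theorem theorem2p6:
  fixes a b \<nu> h :: real and n :: nat
  assumes "a > 0" and "b > 0"
    and "0 < \<nu>" and "\<nu> < 1"
    and "n \<ge> 1"
    and "h = b / a"
  shows
    "kantorovich2 (h powr (1 / 2 ^ (n - 1))) powr r_seq \<nu> n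
        * (a powr (1 - \<nu>) * b powr \<nu>)\<^sup>2
      \<le> ((1 - \<nu>) * a + \<nu> * b)\<^sup>2 - (r_seq \<nu> 0)\<^sup>2 * (a - b)\<^sup>2
        - (\<Sum>k = 1..n - 1. r_seq \<nu> k *
            (a powr (1 - m_idx \<nu> k / 2 ^ k) * b powr (m_idx \<nu> k / 2 ^ k)
             - a powr (1 - (m_idx \<nu> k + 1) / 2 ^ k) * b powr ((m_idx \<nu> k + 1) / 2 ^ k))\<^sup>2)
     \<and> ((1 - \<nu>) * a + \<nu> * b)\<^sup>2 - (r_seq \<nu> 0)\<^sup>2 * (a - b)\<^sup>2
        - (\<Sum>k = 1..n - 1. r_seq \<nu> k *
            (a powr (1 - m_idx \<nu> k / 2 ^ k) * b powr (m_idx \<nu> k / 2 ^ k)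
             - a powr (1 - (m_idx \<nu> k + 1) / 2 ^ k) * b powr ((m_idx \<nu> k + 1) / 2 ^ k))\<^sup>2)
      \<le> kantorovich2 (h powr (1 / 2 ^ (n - 1))) powr R_seq \<nu> n
        * (a powr (1 - \<nu>) * b powr \<nu>)\<^sup>2"
proof -
  obtain N where n: "n = Suc N" using assms by (cases n) auto
  define l where "l = frac (2 ^ n * \<nu>)"
  define s t where "s = m_idx \<nu> n / 2 ^ n" and "t = (m_idx \<nu> n + 1) / 2 ^ n"
  define x y where "x = (geo_mean a b s)\<^sup>2" and "y = (geo_mean a b t)\<^sup>2"
  have pos: "x > 0" "y > 0"
    using assms by (simp_all add: x_def y_def geo_mean_eq_exp)
  have l: "0 \<le> l" "l \<le> 1"
    by (auto simp: l_def frac_lt_1 less_imp_le)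
  have lnx: "ln x = 2 * ((1 - s) * ln a + s * ln b)" "ln y = 2 * ((1 - t) * ln a + t * ln b)"
    using assms by (auto simp: x_def y_def geo_mean_eq_exp ln_realpow)
  have "t - s = 1 / 2 ^ n"
    by (simp add: s_def t_def field_simps)
  \<comment> \<open>\<open>x\<close> and \<open>y\<close> are squares, so their log ratio carries a
    factor 2: the exponent is 1/2^(n-1) and not 1/2^n.\<close>
  then have "2 * (t - s) = 1 / 2 ^ N"
    by (simp add: n)
  moreover have "ln y - ln x = 2 * (t - s) * (ln b - ln a)"
    by (simp add: lnx algebra_simps)
  ultimately have "ln (y / x) = ln (h powr (1 / 2 ^ N))"
    using assms pos by (simp add: ln_div ln_powr)
  then have ratio: "y / x = h powr (1 / 2 ^ (n - 1))"
    using assms pos by (subst (asm) ln_inj_iff) (auto simp: n)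
  \<comment> \<open>\<open>l\<close> is the relative position of \<open>\<nu>\<close> between
    \<open>s\<close> and \<open>t\<close>.\<close>
  have mean: "(1 - l) * s + l * t = \<nu>"
    by (simp add: s_def t_def l_def frac_def m_idx_def field_simps)
  have "(1 - l) * ln x + l * ln y
      = 2 * ((1 - ((1 - l) * s + l * t)) * ln a + ((1 - l) * s + l * t) * ln b)"
    by (simp add: lnx algebra_simps)
  then have geo: "x powr (1 - l) * y powr l = (a powr (1 - \<nu>) * b powr \<nu>)\<^sup>2"
    unfolding mean using assms pos
    by (simp add: powr_def flip: exp_add exp_double)
  have r: "r_seq \<nu> n = min l (1 - l)"
    using assms r_seq_eq_min_frac by (simp add: l_def)
  have "(1 - l) * x + l * y = dyadic_interp a b \<nu> (Suc (n - 1))"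
    by (simp add: dyadic_interp_def l_def x_def y_def s_def t_def n)
  also note dyadic_interp_eq_sum[OF assms(1-4), of "n - 1"]
  finally show ?thesis
    using young_kantorovich[OF pos l]
    unfolding geo ratio geo_mean_def R_seq_def r by simp
qed

end
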